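(* Let $G=(V,E)$ be a simple undirected graph, let $S\subseteq\binom{V}{2}$ be a set of terminal pairs, and let $a^{\mathsf T}x\geq b$ be facet-defining for $\mathrm{MultC}(G,S)$. Then the facet $\{x:a^{\mathsf T}x=b\}\cap\mathrm{MultC}(G,S)$ is bounded if and only if $\mathrm{supp}(a)=G$.
   Context: Given a graph $G=(V,E)$ and $S\subseteq\binom{V}{2}$, an ($S$-)multicut is a set $\delta\subseteq E$ such that for every $\{s,t\}\in S$ the nodes $s$ and $t$ lie in different components of $G-\delta$. For $F\subseteq E$, $x^F\in\mathbb{R}^E$ is its incidence vector. The multicut dominant is $\mathrm{MultC}(G,S)=\mathrm{conv}\{x^\delta:\delta \text{ an } S\text{-multicut}\}+\mathbb{R}^E_{\geq 0}$. For a valid inequality $a^{\mathsf T}x\geq b$, $\mathrm{supp}(a)$ is the subgraph of $G$ induced by the edge set $\{e\in E:a_e\neq 0\}$.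
   Formalization: If G has isolated nodes, supp(a), being induced by edges, never equals G, so the claim fails for bounded facets; supp(a)=G is therefore read as equality of edge sets for every G, and as literal equality of graphs when G has no isolated nodes. *)

theory Defs
  imports "HOL-Analysis.Analysis" "HOL-Library.Ramsey"
begin

text \<open>
  A simple undirected graph is a pair \<open>(V, E)\<close> with edges as two-element sets of nodes. As the
  node type is finite, so are \<open>V\<close> and \<open>E\<close>; \<open>V\<close> need not exhaust the type.
\<close>

definition simple_graph :: "'v::finite set \<Rightarrow> 'v set set \<Rightarrow> bool" where
  "simple_graph V E \<longleftrightarrow> E \<subseteq> nsets V 2"

definition component :: "'v set \<Rightarrow> 'v set set \<Rightarrow> 'v \<Rightarrow> 'v set" where
  "component V E v = {u \<in> V. (v, u) \<in> {(p, q). {p, q} \<in> E}\<^sup>*}"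

definition multicut :: "'v set \<Rightarrow> 'v set set \<Rightarrow> 'v set set \<Rightarrow> 'v set set \<Rightarrow> bool" where
  "multicut V E S \<delta> \<longleftrightarrow>
     \<delta> \<subseteq> E \<and> (\<forall>s t. {s, t} \<in> S \<longrightarrow> component V (E - \<delta>) s \<noteq> component V (E - \<delta>) t)"

text \<open>
  The space \<open>\<real>\<^sup>E\<close> is the coordinate subspace of \<open>real ^ 'v set\<close> in which every
  coordinate not indexed by an edge is zero.
\<close>

definition edge_space :: "'v::finite set set \<Rightarrow> (real ^ 'v set) set" where
  "edge_space E = {x. \<forall>e. e \<notin> E \<longrightarrow> x $ e = 0}"

definition incidence :: "'v::finite set set \<Rightarrow> real ^ 'v set" where
  "incidence F = (\<chi> e. if e \<in> F then 1 else 0)"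

definition MultC :: "'v::finite set \<Rightarrow> 'v set set \<Rightarrow> 'v set set \<Rightarrow> (real ^ 'v set) set" where
  "MultC V E S =
     {x + y | x y. x \<in> convex hull {incidence \<delta> | \<delta>. multicut V E S \<delta>}
                 \<and> y \<in> edge_space E \<and> (\<forall>e. 0 \<le> y $ e)}"

definition facet_defining :: "'a::euclidean_space \<Rightarrow> real \<Rightarrow> 'a set \<Rightarrow> bool" where
  "facet_defining a b P \<longleftrightarrow> (\<forall>x\<in>P. a \<bullet> x \<ge> b) \<and> ({x. a \<bullet> x = b} \<inter> P) facet_of P"

text \<open>
  The nodes of an edge-induced subgraph are the end nodes of its edges, so it never has isolated
  nodes. Hence \<open>supp E a = (V, E)\<close> is possible only if \<open>\<Union>E = V\<close>; for a graph with isolated nodes,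
  the support being the whole graph can only be meant as equality of the edge sets.
\<close>

definition edge_induced :: "'v set set \<Rightarrow> 'v set \<times> 'v set set" where
  "edge_induced F = (\<Union>F, F)"

definition supp :: "'v::finite set set \<Rightarrow> real ^ 'v set \<Rightarrow> 'v set \<times> 'v set set" where
  "supp E a = edge_induced {e \<in> E. a $ e \<noteq> 0}"

end

theory Submission
  imports Defs
begin

text \<open>
  Every nonnegative vector of the edge space is a recession direction of the multicut dominant.
  A valid inequality therefore has nonnegative coefficients, and an edge with coefficient zero
  gives a ray inside the (nonempty) face. If all coefficients are positive, then
  \<open>0 \<le> x\<^sub>e \<le> b / a\<^sub>e\<close> on the face.
\<close>

lemma convex_nonneg_edge_space:
  "convex {x \<in> edge_space E. \<forall>e. 0 \<le> x $ e}"
  by (auto simp: convex_def edge_space_def)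

text \<open>Incidence vectors of multicuts lie in the nonnegative orthant of the edge space. This
  orthant is convex, so it contains their hull, and it is closed under adding the nonnegative
  \<open>y\<close>.\<close>

lemma MultC_subset_nonneg_edge_space:
  "MultC V E S \<subseteq> {x \<in> edge_space E. \<forall>e. 0 \<le> x $ e}"
proof -
  have "convex hull {incidence \<delta> | \<delta>. multicut V E S \<delta>} \<subseteq> {x \<in> edge_space E. \<forall>e. 0 \<le> x $ e}"
  proof (rule hull_minimal)
    show "{incidence \<delta> | \<delta>. multicut V E S \<delta>} \<subseteq> {x \<in> edge_space E. \<forall>e. 0 \<le> x $ e}"
      by (auto simp: multicut_def incidence_def edge_space_def)
  qed (rule convex_nonneg_edge_space)
  then show ?thesis
    by (fastforce simp: MultC_def edge_space_def)
qed

text \<open>The step along the axis is absorbed into the nonnegative summand \<open>y\<close>; the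
  hull point \<open>u\<close> stays fixed.\<close>

lemma MultC_add_axis:
  assumes "x \<in> MultC V E S" "e \<in> E" "0 \<le> t"
  shows "x + t *\<^sub>R axis e 1 \<in> MultC V E S"
proof -
  obtain u y where u: "u \<in> convex hull {incidence \<delta> | \<delta>. multicut V E S \<delta>}"
    and y: "y \<in> edge_space E" "\<forall>e. 0 \<le> y $ e" and x: "x = u + y"
    using assms(1) by (auto simp: MultC_def)
  have "y + t *\<^sub>R axis e 1 \<in> edge_space E" "\<forall>i. 0 \<le> (y + t *\<^sub>R axis e 1) $ i"
    using y assms(2,3) by (auto simp: edge_space_def axis_def)
  then show ?thesis
    unfolding MultC_def x add.assoc using u by blast
qed

text \<open>Since the inequality is tight at \<open>x\<close>, a unit step along \<open>e\<close>
  raises the left-hand side from \<open>b\<close> to \<open>b + a $ e\<close>, which validity keeps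
  at least \<open>b\<close>.\<close>

lemma valid_inequality_nonneg:
  assumes valid: "\<forall>x\<in>MultC V E S. a \<bullet> x \<ge> b"
    and x: "x \<in> MultC V E S" "a \<bullet> x = b" and e: "e \<in> E"
  shows "0 \<le> a $ e"
  using bspec[OF valid MultC_add_axis[OF x(1) e, of 1]] x(2)
  by (simp add: inner_add_right inner_axis)

lemma face_bounded_iff:
  assumes valid: "\<forall>x\<in>MultC V E S. a \<bullet> x \<ge> b"
    and nonempty: "{x. a \<bullet> x = b} \<inter> MultC V E S \<noteq> {}"
    and a: "a \<in> edge_space E"
  shows "bounded ({x. a \<bullet> x = b} \<inter> MultC V E S) \<longleftrightarrow> {e \<in> E. a $ e \<noteq> 0} = E"
    (is "bounded ?F \<longleftrightarrow> _")
proof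
  obtain x where x: "x \<in> MultC V E S" "a \<bullet> x = b"
    using nonempty by auto
  {
    assume "bounded ?F"
    then obtain B where B: "\<forall>z\<in>?F. norm z \<le> B"
      by (auto simp: bounded_iff)
    show "{e \<in> E. a $ e \<noteq> 0} = E"
    proof (rule ccontr)
      assume "{e \<in> E. a $ e \<noteq> 0} \<noteq> E"
      then obtain e where e: "e \<in> E" "a $ e = 0"
        by auto
      \<comment> \<open>As \<open>x $ e\<close> is nonnegative, coordinate \<open>e\<close> of
        \<open>?z\<close> is at least \<open>t\<close>, hence exceeds \<open>B\<close>. The absolute
        value ensures \<open>0 \<le> t\<close> whatever the sign of \<open>B\<close>.\<close>
      define t where "t = \<bar>B\<bar> + 1"
      let ?z = "x + t *\<^sub>R axis e 1"
      have "0 \<le> t"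
        by (simp add: t_def)
      then have "?z \<in> ?F"
        using MultC_add_axis[OF x(1) e(1)] x(2) e(2) by (simp add: inner_add_right inner_axis)
      then have "norm ?z \<le> B"
        using B by blast
      moreover have "0 \<le> x $ e"
        using x(1) MultC_subset_nonneg_edge_space by blast
      then have "t \<le> \<bar>?z $ e\<bar>"
        by (simp add: axis_def)
      ultimately show False
        using component_le_norm_cart[of ?z e] by (simp add: t_def)
    qed
  next
    assume supp: "{e \<in> E. a $ e \<noteq> 0} = E"
    have pos: "0 < a $ e" if "e \<in> E" for e
    proof -
      have "a $ e \<noteq> 0"
        using supp that by blast
      then show ?thesis
        using valid_inequality_nonneg[OF valid x that] by simp
    qed
    have nonneg: "0 \<le> a $ e" for e
      using pos[of e] a by (cases "e \<in> E") (auto simp: edge_space_def)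
    \<comment> \<open>The norm is bounded by the sum of the absolute coordinates. For
      \<open>e\<close> outside \<open>E\<close> both \<open>z $ e\<close> and \<open>a $ e\<close>
      vanish, and the summand \<open>b / 0\<close> is 0 in HOL.\<close>
    have "norm z \<le> (\<Sum>e\<in>UNIV. \<bar>b / a $ e\<bar>)" if "z \<in> ?F" for z
    proof -
      have z: "a \<bullet> z = b" "z \<in> edge_space E" "\<And>e. 0 \<le> z $ e"
        using that MultC_subset_nonneg_edge_space by blast+
      have "\<bar>z $ e\<bar> \<le> \<bar>b / a $ e\<bar>" for e
      proof (cases "e \<in> E")
        case True
        \<comment> \<open>No term of the inner product is negative, so each one is at most the whole
          sum \<open>b\<close>.\<close>
        have "a $ e * z $ e \<le> (\<Sum>i\<in>UNIV. a $ i * z $ i)"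
          by (rule member_le_sum) (auto simp: nonneg z(3))
        also have "\<dots> = b"
          using z(1) by (simp add: inner_vec_def)
        finally have "z $ e \<le> b / a $ e"
          using pos[OF True] by (simp add: field_simps)
        then show ?thesis
          using z(3)[of e] by linarith
      next
        case False
        then show ?thesis
          using z(2) by (simp add: edge_space_def)
      qed
      then have "(\<Sum>e\<in>UNIV. \<bar>z $ e\<bar>) \<le> (\<Sum>e\<in>UNIV. \<bar>b / a $ e\<bar>)"
        by (rule sum_mono)
      then show ?thesis
        using norm_le_l1_cart[of z] by linarith
    qed
    then show "bounded ?F"
      by (auto simp: bounded_iff)
  }
qed

theorem theorem3p5:
  fixes V :: "'v::finite set" and E S :: "'v set set"
    and a :: "real ^ 'v set" and b :: real
  assumes "simple_graph V E"
    and "S \<subseteq> nsets V 2"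
    and "a \<in> edge_space E"
    and "facet_defining a b (MultC V E S)"
  shows "(bounded ({x. a \<bullet> x = b} \<inter> MultC V E S) \<longleftrightarrow> snd (supp E a) = E) \<and>
         (\<Union>E = V \<longrightarrow>
           (bounded ({x. a \<bullet> x = b} \<inter> MultC V E S) \<longleftrightarrow> supp E a = (V, E)))"
proof -
  \<comment> \<open>A facet is nonempty by definition; this supplies the point where the rays
    start.\<close>
  have "\<forall>x\<in>MultC V E S. a \<bullet> x \<ge> b" "{x. a \<bullet> x = b} \<inter> MultC V E S \<noteq> {}"
    using assms(4) by (auto simp: facet_defining_def facet_of_def)
  from face_bounded_iff[OF this assms(3)] show ?thesis
    \<comment> \<open>If the edges cover \<open>V\<close>, equal edge sets also give equal node
      sets.\<close>
    unfolding supp_def edge_induced_def by auto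
qed

end
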